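(* Let $V$, $H$ be real Hilbert spaces and $A : V \to H$ a bounded injective linear operator with adjoint $A^* : H \to V$. Let $\delta > 0$ and let $g^\delta \in H$ satisfy $\|g_\perp^\delta\|_H < \delta < \|g^\delta\|_H$. Then the problem $$\inf_{q \in H} \left( \frac{1}{2}\|A^* q\|_V^2 + \delta \|q\|_H - (g^\delta, q)_H \right)$$ has at least one solution. For any solution $p^\delta$, the element $u^\delta = A^* p^\delta$ coincides with the Tikhonov solution $u_{\varepsilon}^\delta$ for $\varepsilon = \varepsilon(\delta)$, where $\varepsilon(\delta)$ is the unique value of $\varepsilon > 0$ such that $\|A u_\varepsilon^\delta - g^\delta\|_H = \delta$. Moreover, $p^\delta \neq 0$ and $$\varepsilon(\delta) = \frac{\delta}{\|p^\delta\|_H}.$$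
   Context: $g_\perp^\delta$ denotes the orthogonal projection of $g^\delta$ on $(\mathrm{Range}\, A)^\perp \subset H$. For $\varepsilon > 0$, the Tikhonov solution $u_\varepsilon^\delta \in V$ is the unique solution of $(Au_\varepsilon^\delta, Av)_H + \varepsilon (u_\varepsilon^\delta, v)_V = (g^\delta, Av)_H$ for all $v \in V$. Under the assumption on $g^\delta$, there is exactly one $\varepsilon>0$ with $\|A u_\varepsilon^\delta - g^\delta\|_H = \delta$. *)

theory Defs
  imports "HOL-Analysis.Analysis"
begin

(* A real Hilbert space is a type of sort {real_inner, complete_space}, of any dimension. The
   library's adjoint is a SOME-description over real_inner; for a bounded linear map out of a
   Hilbert space the Riesz theorem makes the described map exist and be unique. The projection
   below exists and is unique when S is a closed subspace, as is any orthogonal complement. The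
   library's closest_point is not usable here: its sort heine_borel forces finite dimension. *)

definition orthogonal_projection :: "'h::{real_inner, complete_space} set \<Rightarrow> 'h \<Rightarrow> 'h" where
  "orthogonal_projection S g = (THE p. p \<in> S \<and> g - p \<in> S\<^sup>\<bottom>)"

definition is_tikhonov_solution ::
    "('v::{real_inner, complete_space} \<Rightarrow> 'h::{real_inner, complete_space}) \<Rightarrow> 'h \<Rightarrow> real \<Rightarrow> 'v \<Rightarrow> bool"
  where
  "is_tikhonov_solution A g \<epsilon> u \<longleftrightarrow> (\<forall>v. inner (A u) (A v) + \<epsilon> * inner u v = inner g (A v))"

definition tikhonov_solution ::
    "('v::{real_inner, complete_space} \<Rightarrow> 'h::{real_inner, complete_space}) \<Rightarrow> 'h \<Rightarrow> real \<Rightarrow> 'v"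
  where
  "tikhonov_solution A g \<epsilon> = (THE u. is_tikhonov_solution A g \<epsilon> u)"

definition is_discrepancy_parameter ::
    "('v::{real_inner, complete_space} \<Rightarrow> 'h::{real_inner, complete_space}) \<Rightarrow> 'h \<Rightarrow> real \<Rightarrow> real \<Rightarrow> bool"
  where
  "is_discrepancy_parameter A g \<delta> \<epsilon> \<longleftrightarrow> \<epsilon> > 0 \<and> norm (A (tikhonov_solution A g \<epsilon>) - g) = \<delta>"

definition discrepancy_parameter ::
    "('v::{real_inner, complete_space} \<Rightarrow> 'h::{real_inner, complete_space}) \<Rightarrow> 'h \<Rightarrow> real \<Rightarrow> real"
  where
  "discrepancy_parameter A g \<delta> = (THE \<epsilon>. is_discrepancy_parameter A g \<delta> \<epsilon>)"

definition dual_functional ::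
    "('v::{real_inner, complete_space} \<Rightarrow> 'h::{real_inner, complete_space}) \<Rightarrow> 'h \<Rightarrow> real \<Rightarrow> 'h \<Rightarrow> real"
  where
  "dual_functional A g \<delta> q = 1 / 2 * (norm (adjoint A q))\<^sup>2 + \<delta> * norm q - inner g q"

definition is_dual_solution ::
    "('v::{real_inner, complete_space} \<Rightarrow> 'h::{real_inner, complete_space}) \<Rightarrow> 'h \<Rightarrow> real \<Rightarrow> 'h \<Rightarrow> bool"
  where
  "is_dual_solution A g \<delta> p \<longleftrightarrow> (\<forall>q. dual_functional A g \<delta> p \<le> dual_functional A g \<delta> q)"

end

theory Submission
  imports Defs
begin

text \<open>
  The dual problem can be solved explicitly. Suppose that the discrepancy equation
  \<open>norm (A u - g) = \<delta>\<close> holds for the Tikhonov solution \<open>u\<close> with parameter \<open>\<epsilon>\<close>, and rescale the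
  residual to \<open>p = (g - A u) / \<epsilon>\<close>. The Tikhonov equation says \<open>A\<^sup>* p = u\<close>, and the discrepancy
  equation says \<open>\<epsilon> * norm p = \<delta>\<close>. Substituting \<open>g = A u + \<epsilon> p\<close> into the dual functional and
  completing the square gives, for every \<open>q\<close>, the value
  \<open>- (norm u)\<^sup>2 / 2 + (norm (A\<^sup>* q - u))\<^sup>2 / 2 + \<epsilon> * (norm p * norm q - inner p q)\<close>.
  The last two terms are nonnegative and vanish for \<open>q = p\<close>, so \<open>p\<close> is a dual solution. If they
  vanish for some \<open>q\<close>, equality in the Cauchy-Schwarz inequality makes \<open>q\<close> a nonnegative multiple of
  \<open>p\<close>, and \<open>A\<^sup>* q = u = A\<^sup>* p\<close> with \<open>u \<noteq> 0\<close> forces \<open>q = p\<close>. Hence \<open>p\<close> is the only dual solution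
  (\<open>is_dual_solution_iff_residual\<close>). This replaces both a weak compactness argument for the existence
  of dual solutions and a subdifferential calculus for their characterization. It also gives the
  uniqueness of \<open>\<epsilon>\<close>: every discrepancy parameter equals \<open>\<delta> / norm p\<close> for the same \<open>p\<close>.

  What remains is that a discrepancy parameter exists
  (\<open>is_discrepancy_parameter_exists\<close>). The residual norm depends continuously on \<open>\<epsilon>\<close>; it exceeds
  \<open>\<delta>\<close> for large \<open>\<epsilon>\<close>, where the Tikhonov solution is small and \<open>\<delta> < norm g\<close>; and it is below \<open>\<delta>\<close>
  for small \<open>\<epsilon>\<close>, because the component of \<open>g\<close> orthogonal to the range of \<open>A\<close> is shorter than \<open>\<delta>\<close>
  and so some \<open>A v\<close> lies within \<open>\<delta>\<close> of \<open>g\<close>. The intermediate value theorem then applies.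

  The Hilbert space input is the projection theorem for closed subspaces. Applied to kernels it
  gives the Riesz theorem and hence the adjoint, applied to a scaled graph of \<open>A\<close> it gives the
  Tikhonov solutions, and applied to the closure of the range of \<open>A\<close> it identifies the projection of
  \<open>g\<close> onto the orthogonal complement.
\<close>

section \<open>Orthogonal projection in Hilbert spaces\<close>

text \<open>
  The foot point is the limit of a minimizing sequence for the distance to \<open>x\<close>. Midpoints of members
  of \<open>M\<close> stay in \<open>M\<close>, so the parallelogram law makes the sequence Cauchy; perturbing the minimizer
  within \<open>M\<close> gives orthogonality.
\<close>

lemma orthogonal_projection_exists:
  fixes M :: "'a::{real_inner, complete_space} set"
  assumes "subspace M" and "closed M"
  obtains p where "p \<in> M" and "\<And>m. m \<in> M \<Longrightarrow> inner (x - p) m = 0"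
proof -
  define d where "d = (INF m\<in>M. (norm (x - m))\<^sup>2)"
  have bdd: "bdd_below ((\<lambda>m. (norm (x - m))\<^sup>2) ` M)"
    by (rule bdd_belowI[of _ 0]) auto
  have ne: "M \<noteq> {}"
    using subspace_0[OF assms(1)] by auto
  have d_le: "d \<le> (norm (x - m))\<^sup>2" if "m \<in> M" for m
    unfolding d_def using bdd that by (rule cINF_lower)
  have "\<exists>m\<in>M. (norm (x - m))\<^sup>2 < d + 1 / real (Suc n)" for n
  proof -
    have "d < d + 1 / real (Suc n)" by simp
    then show ?thesis
      unfolding d_def using cINF_less_iff[OF ne bdd] by blast
  qed
  then obtain y where yM: "\<And>n. y n \<in> M"
    and y_less: "\<And>n. (norm (x - y n))\<^sup>2 < d + 1 / real (Suc n)"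
    by metis
  have y_dist: "(norm (y i - y j))\<^sup>2 \<le> 2 / real (Suc i) + 2 / real (Suc j)" for i j
  proof -
    have "(1 / 2) *\<^sub>R (y i + y j) \<in> M"
      using assms(1) yM by (simp add: subspace_add subspace_scale)
    then have "d \<le> (norm (x - (1 / 2) *\<^sub>R (y i + y j)))\<^sup>2"
      by (rule d_le)
    moreover have "(norm (y i - y j))\<^sup>2 = 2 * (norm (x - y i))\<^sup>2 + 2 * (norm (x - y j))\<^sup>2
        - 4 * (norm (x - (1 / 2) *\<^sub>R (y i + y j)))\<^sup>2"
      by (simp add: power2_norm_eq_inner inner_simps inner_commute algebra_simps)
    ultimately show ?thesis
      using y_less[of i] y_less[of j] by linarith
  qed
  have "Cauchy y"
  proof (rule metric_CauchyI)
    fix e :: real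
    assume e: "e > 0"
    obtain N where N: "4 / e\<^sup>2 < real N"
      using reals_Archimedean2 by blast
    have "dist (y i) (y j) < e" if "i \<ge> N" "j \<ge> N" for i j
    proof -
      have small: "2 / real (Suc k) < e\<^sup>2 / 2" if "k \<ge> N" for k
      proof -
        have "4 / e\<^sup>2 < real (Suc k)" using N that by linarith
        then show ?thesis using e by (simp add: field_simps)
      qed
      have "(norm (y i - y j))\<^sup>2 < e\<^sup>2"
        using y_dist[of i j] small[OF that(1)] small[OF that(2)] by linarith
      then show ?thesis
        using e by (auto simp: dist_norm intro: power2_less_imp_less)
    qed
    then show "\<exists>N. \<forall>i\<ge>N. \<forall>j\<ge>N. dist (y i) (y j) < e"
      by blast
  qed
  then obtain p where p: "y \<longlonglongrightarrow> p"
    using Cauchy_convergent convergent_def by blast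
  have pM: "p \<in> M"
    using closed_sequentially[OF assms(2) _ p] yM by blast
  have p_le: "(norm (x - p))\<^sup>2 \<le> d"
  proof (rule LIMSEQ_le)
    show "(\<lambda>n. (norm (x - y n))\<^sup>2) \<longlonglongrightarrow> (norm (x - p))\<^sup>2"
      by (intro tendsto_intros p)
    show "(\<lambda>n. d + 1 / real (Suc n)) \<longlonglongrightarrow> d"
      using tendsto_add[OF tendsto_const[of d] LIMSEQ_inverse_real_of_nat]
      by (simp add: inverse_eq_divide)
    show "\<exists>N. \<forall>n\<ge>N. (norm (x - y n))\<^sup>2 \<le> d + 1 / real (Suc n)"
      using y_less less_imp_le by blast
  qed
  have "inner (x - p) m = 0" if m: "m \<in> M" for m
  proof (rule ccontr)
    assume nz: "inner (x - p) m \<noteq> 0"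
    then have m_pos: "inner m m > 0" by auto
    \<comment> \<open>this step length minimizes the distance from \<open>x\<close> to \<open>p + t m\<close>\<close>
    define t where "t = inner (x - p) m / inner m m"
    have "p + t *\<^sub>R m \<in> M"
      using assms(1) pM m by (simp add: subspace_add subspace_scale)
    then have "(norm (x - p))\<^sup>2 \<le> (norm (x - (p + t *\<^sub>R m)))\<^sup>2"
      using d_le p_le order_trans by blast
    also have "\<dots> = (norm (x - p))\<^sup>2 - 2 * t * inner (x - p) m + t * (t * inner m m)"
      by (simp add: power2_norm_eq_inner inner_simps inner_commute algebra_simps)
    also have "t * inner m m = inner (x - p) m"
      using m_pos by (simp add: t_def)
    finally have "t * inner (x - p) m \<le> 0" by simp
    moreover have "t * inner (x - p) m > 0"
      using nz m_pos by (auto simp: t_def zero_less_mult_iff zero_less_divide_iff neq_iff)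
    ultimately show False by linarith
  qed
  with pM show thesis by (rule that)
qed

text \<open>
  A nonzero vector orthogonal to the kernel of \<open>l\<close> represents \<open>l\<close> up to a scalar, since the kernel
  has codimension one.
\<close>

lemma Riesz_representation:
  fixes l :: "'a::{real_inner, complete_space} \<Rightarrow> real"
  assumes "bounded_linear l"
  shows "\<exists>w. \<forall>v. l v = inner v w"
proof (cases "\<forall>v. l v = 0")
  case True
  then show ?thesis by (intro exI[of _ 0]) simp
next
  case False
  interpret l: bounded_linear l by fact
  obtain x where x: "l x \<noteq> 0" using False by blast
  have "subspace {v. l v = 0}"
    by (auto simp: subspace_def l.add l.scaleR l.zero)
  moreover have "closed {v. l v = 0}"
    by (intro closed_Collect_eq l.continuous_on continuous_intros)
  ultimately obtain p where p: "l p = 0" "\<And>m. l m = 0 \<Longrightarrow> inner (x - p) m = 0"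
    using orthogonal_projection_exists[of "{v. l v = 0}" x] by auto
  define z where "z = x - p"
  have lz: "l z \<noteq> 0" using x p(1) by (simp add: z_def l.diff)
  then have "z \<noteq> 0" by (auto simp: l.zero)
  then have z: "inner z z \<noteq> 0" by simp
  have "l v = inner v ((l z / inner z z) *\<^sub>R z)" for v
  proof -
    have "inner z (v - (l v / l z) *\<^sub>R z) = 0"
      unfolding z_def by (rule p(2)) (use lz in \<open>simp add: l.diff l.scaleR flip: z_def\<close>)
    then show ?thesis
      using lz z by (simp add: inner_simps inner_commute field_simps)
  qed
  then show ?thesis by blast
qed

text \<open>
  The constant \<open>adjoint\<close> picks some map with this property; the Riesz theorem provides one.
\<close>

lemma adjoint_inner:
  fixes A :: "'v::{real_inner, complete_space} \<Rightarrow> 'h::real_inner"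
  assumes "bounded_linear A"
  shows "inner v (adjoint A q) = inner (A v) q"
proof -
  have "\<exists>w. \<forall>v. inner (A v) q = inner v w" for q
    using Riesz_representation[OF bounded_linear_compose[OF bounded_linear_inner_left assms]] .
  then have "\<exists>f. \<forall>v q. inner (A v) q = inner v (f q)"
    by metis
  then have "\<forall>v q. inner (A v) q = inner v (adjoint A q)"
    unfolding adjoint_def by (rule someI_ex)
  then show ?thesis by simp
qed

lemma subspace_closure:
  fixes S :: "'a::real_normed_vector set"
  assumes "subspace S"
  shows "subspace (closure S)"
proof (rule subspaceI)
  show "0 \<in> closure S"
    using subspace_0[OF assms] closure_subset by blast
next
  fix x y
  assume "x \<in> closure S" and "y \<in> closure S"
  then obtain a b where "\<And>n. a n \<in> S" "a \<longlonglongrightarrow> x" "\<And>n. b n \<in> S" "b \<longlonglongrightarrow> y"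
    unfolding closure_sequential by blast
  then have "\<forall>n. a n + b n \<in> S" and "(\<lambda>n. a n + b n) \<longlonglongrightarrow> x + y"
    using subspace_add[OF assms] by (auto intro: tendsto_add)
  then show "x + y \<in> closure S"
    unfolding closure_sequential by (intro exI[of _ "\<lambda>n. a n + b n"] conjI)
next
  fix c :: real and x
  assume "x \<in> closure S"
  then show "c *\<^sub>R x \<in> closure S"
    using closure_scaleR[of c S] closure_mono[of "(*\<^sub>R) c ` S" S] subspace_scale[OF assms]
    by auto
qed

text \<open>
  If \<open>r\<close> is the projection of \<open>g\<close> onto the closure of the range, then \<open>g - r\<close> is the projection onto
  the orthogonal complement of the range. So the length of the latter is the distance from \<open>g\<close> to
  the range.
\<close>

lemma near_orthogonal_projection_range:
  fixes A :: "'v::real_normed_vector \<Rightarrow> 'h::{real_inner, complete_space}"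
  assumes "bounded_linear A" and "norm (orthogonal_projection ((range A)\<^sup>\<bottom>) g) < \<delta>"
  obtains v where "norm (A v - g) < \<delta>"
proof -
  interpret A: bounded_linear A by fact
  have "subspace (closure (range A))"
    by (intro subspace_closure linear_subspace_image A.linear subspace_UNIV)
  then obtain r where r: "r \<in> closure (range A)"
    and orth: "\<And>m. m \<in> closure (range A) \<Longrightarrow> inner (g - r) m = 0"
    using orthogonal_projection_exists[of "closure (range A)" g] by auto
  have comp: "y \<in> (range A)\<^sup>\<bottom> \<longleftrightarrow> (\<forall>v. inner (A v) y = 0)" for y
    by (auto simp: orthogonal_comp_def orthogonal_def)
  have "g - r \<in> (range A)\<^sup>\<bottom>"
    using orth closure_subset[of "range A"] by (auto simp: comp inner_commute)
  moreover have "g - (g - r) \<in> ((range A)\<^sup>\<bottom>)\<^sup>\<bottom>"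
  proof -
    have "inner y r = 0" if "y \<in> (range A)\<^sup>\<bottom>" for y
    proof -
      have "closed {x. inner y x = 0}"
        by (intro closed_Collect_eq continuous_intros)
      moreover have "range A \<subseteq> {x. inner y x = 0}"
        using that by (auto simp: comp inner_commute)
      ultimately show ?thesis
        using r closure_minimal by blast
    qed
    then show ?thesis by (simp add: orthogonal_comp_def orthogonal_def)
  qed
  ultimately have proj: "orthogonal_projection ((range A)\<^sup>\<bottom>) g = g - r"
    unfolding orthogonal_projection_def
  proof (intro the_equality conjI)
    fix p
    assume p: "p \<in> (range A)\<^sup>\<bottom> \<and> g - p \<in> ((range A)\<^sup>\<bottom>)\<^sup>\<bottom>"
    assume q: "g - r \<in> (range A)\<^sup>\<bottom>" "g - (g - r) \<in> ((range A)\<^sup>\<bottom>)\<^sup>\<bottom>"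
    have "p - (g - r) \<in> (range A)\<^sup>\<bottom>"
      using p q(1) by (simp add: comp inner_diff_right)
    then have "inner (p - (g - r)) (g - p) = 0" "inner (p - (g - r)) r = 0"
      using p q(2) by (auto simp: orthogonal_comp_def orthogonal_def)
    then have "inner (p - (g - r)) (p - (g - r)) = 0"
      by (simp add: inner_simps)
    then show "p = g - r" by simp
  qed
  have "\<delta> - norm (g - r) > 0"
    using assms(2) proj by simp
  then obtain v where v: "dist (A v) r < \<delta> - norm (g - r)"
    using r unfolding closure_approachable by blast
  have "norm (A v - g) \<le> norm (A v - r) + norm (g - r)"
    using norm_triangle_ineq4[of "A v - r" "g - r"] by simp
  also have "\<dots> < \<delta>" using v by (simp add: dist_norm)
  finally show thesis by (rule that)
qed

section \<open>Tikhonov solutions\<close>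

text \<open>
  The Tikhonov equation is the stationarity condition of the quadratic functional
  \<open>(norm (A v - g))\<^sup>2 + \<epsilon> * (norm v)\<^sup>2\<close>, whose expansion around a stationary point has no linear
  term. For \<open>\<epsilon> > 0\<close> this yields both minimality and uniqueness of Tikhonov solutions.
\<close>

lemma tikhonov_energy_identity:
  assumes "bounded_linear A" and "is_tikhonov_solution A g \<epsilon> u"
  shows "(norm (A v - g))\<^sup>2 + \<epsilon> * (norm v)\<^sup>2 = (norm (A u - g))\<^sup>2 + \<epsilon> * (norm u)\<^sup>2
    + ((norm (A (v - u)))\<^sup>2 + \<epsilon> * (norm (v - u))\<^sup>2)"
proof -
  interpret A: bounded_linear A by fact
  have "inner (A u) (A (v - u)) + \<epsilon> * inner u (v - u) = inner g (A (v - u))"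
    using assms(2) unfolding is_tikhonov_solution_def by blast
  then show ?thesis
    by (simp add: A.diff power2_norm_eq_inner inner_simps inner_commute algebra_simps)
qed

text \<open>
  In the product of the two spaces, the Tikhonov functional is the squared distance from \<open>(g, 0)\<close> to
  the point \<open>(A v, sqrt \<epsilon> *\<^sub>R v)\<close>. These points form a closed subspace, and orthogonality at the
  projection of \<open>(g, 0)\<close> onto it is the Tikhonov equation.
\<close>

lemma is_tikhonov_solution_exists:
  fixes A :: "'v::{real_inner, complete_space} \<Rightarrow> 'h::{real_inner, complete_space}"
  assumes "bounded_linear A" and "\<epsilon> > 0"
  obtains u where "is_tikhonov_solution A g \<epsilon> u"
proof -
  interpret A: bounded_linear A by fact
  define M where "M = {z :: 'h \<times> 'v. A (snd z) = sqrt \<epsilon> *\<^sub>R fst z}"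
  have "subspace M"
    by (auto simp: M_def subspace_def A.add A.scaleR A.zero algebra_simps)
  moreover have "closed M"
    unfolding M_def by (intro closed_Collect_eq A.continuous_on continuous_intros)
  ultimately obtain z where z: "z \<in> M" and orth: "\<And>m. m \<in> M \<Longrightarrow> inner ((g, 0) - z) m = 0"
    using orthogonal_projection_exists[of M "(g, 0)"] by blast
  define u where "u = (1 / sqrt \<epsilon>) *\<^sub>R snd z"
  have z_eq: "z = (A u, sqrt \<epsilon> *\<^sub>R u)"
    using z assms(2) by (auto simp: M_def u_def A.scaleR prod_eq_iff)
  have "inner (A u) (A v) + \<epsilon> * inner u v = inner g (A v)" for v
  proof -
    have "(A v, sqrt \<epsilon> *\<^sub>R v) \<in> M"
      by (simp add: M_def A.scaleR)
    from orth[OF this] have "inner (g - A u) (A v) = (sqrt \<epsilon> * sqrt \<epsilon>) * inner u v"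
      by (simp add: z_eq inner_simps)
    then show ?thesis
      using assms(2) by (simp add: inner_simps)
  qed
  then show thesis
    using that unfolding is_tikhonov_solution_def by blast
qed

lemma is_tikhonov_solution_unique:
  assumes "bounded_linear A" and "\<epsilon> > 0"
    and "is_tikhonov_solution A g \<epsilon> u" and "is_tikhonov_solution A g \<epsilon> w"
  shows "u = w"
proof -
  have "((norm (A (w - u)))\<^sup>2 + \<epsilon> * (norm (w - u))\<^sup>2)
      + ((norm (A (u - w)))\<^sup>2 + \<epsilon> * (norm (u - w))\<^sup>2) = 0"
    using tikhonov_energy_identity[OF assms(1,3), of w] tikhonov_energy_identity[OF assms(1,4), of u]
    by linarith
  moreover have "\<epsilon> * (norm (w - u))\<^sup>2 \<ge> 0" "\<epsilon> * (norm (u - w))\<^sup>2 \<ge> 0"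
    using assms(2) by auto
  ultimately have "\<epsilon> * (norm (u - w))\<^sup>2 = 0"
    using zero_le_power2[of "norm (A (w - u))"] zero_le_power2[of "norm (A (u - w))"] by linarith
  then show ?thesis using assms(2) by simp
qed

lemma tikhonov_solution_iff:
  fixes A :: "'v::{real_inner, complete_space} \<Rightarrow> 'h::{real_inner, complete_space}"
  assumes "bounded_linear A" and "\<epsilon> > 0"
  shows "is_tikhonov_solution A g \<epsilon> u \<longleftrightarrow> u = tikhonov_solution A g \<epsilon>"
proof -
  obtain w where w: "is_tikhonov_solution A g \<epsilon> w"
    using is_tikhonov_solution_exists[OF assms] .
  then have "tikhonov_solution A g \<epsilon> = w"
    unfolding tikhonov_solution_def using is_tikhonov_solution_unique[OF assms] by blast
  then show ?thesis
    using w is_tikhonov_solution_unique[OF assms] by blast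
qed

section \<open>Existence of a discrepancy parameter\<close>

text \<open>
  Subtract the two Tikhonov equations and test with the difference of the solutions.
\<close>

lemma tikhonov_solution_stability:
  fixes A :: "'v::{real_inner, complete_space} \<Rightarrow> 'h::{real_inner, complete_space}"
  assumes "bounded_linear A" and "\<epsilon> > 0" and "\<eta> > 0"
  shows "norm (tikhonov_solution A g \<epsilon> - tikhonov_solution A g \<eta>)
    \<le> \<bar>\<eta> - \<epsilon>\<bar> / \<epsilon> * norm (tikhonov_solution A g \<eta>)"
proof -
  interpret A: bounded_linear A by fact
  define u where "u = tikhonov_solution A g \<epsilon>"
  define w where "w = tikhonov_solution A g \<eta>"
  have "is_tikhonov_solution A g \<epsilon> u" "is_tikhonov_solution A g \<eta> w"
    using assms tikhonov_solution_iff by (auto simp: u_def w_def)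
  then have "inner (A u) (A (u - w)) + \<epsilon> * inner u (u - w)
      = inner (A w) (A (u - w)) + \<eta> * inner w (u - w)"
    unfolding is_tikhonov_solution_def by simp
  then have "inner (A (u - w)) (A (u - w)) + \<epsilon> * inner (u - w) (u - w) = (\<eta> - \<epsilon>) * inner w (u - w)"
    by (simp add: A.diff inner_simps algebra_simps)
  then have "\<epsilon> * (norm (u - w))\<^sup>2 \<le> (\<eta> - \<epsilon>) * inner w (u - w)"
    using inner_ge_zero[of "A (u - w)"] unfolding power2_norm_eq_inner by linarith
  also have "\<dots> \<le> \<bar>\<eta> - \<epsilon>\<bar> * \<bar>inner w (u - w)\<bar>"
    by (metis abs_ge_self abs_mult)
  also have "\<dots> \<le> \<bar>\<eta> - \<epsilon>\<bar> * (norm w * norm (u - w))"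
    by (intro mult_left_mono Cauchy_Schwarz_ineq2) simp
  finally have "(\<epsilon> * norm (u - w)) * norm (u - w) \<le> (\<bar>\<eta> - \<epsilon>\<bar> * norm w) * norm (u - w)"
    by (simp add: power2_eq_square mult.assoc)
  then have "\<epsilon> * norm (u - w) \<le> \<bar>\<eta> - \<epsilon>\<bar> * norm w"
    by (cases "norm (u - w) = 0") (simp_all add: mult_le_cancel_right)
  then show ?thesis
    unfolding u_def[symmetric] w_def[symmetric] using assms(2) by (simp add: field_simps)
qed

lemma continuous_on_tikhonov_solution:
  fixes A :: "'v::{real_inner, complete_space} \<Rightarrow> 'h::{real_inner, complete_space}"
  assumes "bounded_linear A"
  shows "continuous_on {0<..} (tikhonov_solution A g)"
  unfolding continuous_on_def
proof
  fix \<eta> :: real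
  assume \<eta>: "\<eta> \<in> {0<..}"
  let ?u = "tikhonov_solution A g"
  have "continuous_on {0<..} (\<lambda>\<epsilon>. \<bar>\<eta> - \<epsilon>\<bar> / \<epsilon> * norm (?u \<eta>))"
    by (intro continuous_on_mult continuous_on_divide continuous_on_rabs continuous_on_diff
        continuous_on_const continuous_on_id) auto
  then have lim: "((\<lambda>\<epsilon>. \<bar>\<eta> - \<epsilon>\<bar> / \<epsilon> * norm (?u \<eta>)) \<longlongrightarrow> \<bar>\<eta> - \<eta>\<bar> / \<eta> * norm (?u \<eta>)) (at \<eta> within {0<..})"
    unfolding continuous_on_def using \<eta> by (rule bspec)
  have "\<forall>\<^sub>F \<epsilon> in at \<eta> within {0<..}. norm (?u \<epsilon> - ?u \<eta>) \<le> \<bar>\<eta> - \<epsilon>\<bar> / \<epsilon> * norm (?u \<eta>)"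
    using tikhonov_solution_stability[OF assms] \<eta>
    by (intro eventually_at_filter[THEN iffD2] always_eventually) auto
  then have "((\<lambda>\<epsilon>. ?u \<epsilon> - ?u \<eta>) \<longlongrightarrow> 0) (at \<eta> within {0<..})"
    by (rule Lim_null_comparison) (use lim in simp)
  then show "(?u \<longlongrightarrow> ?u \<eta>) (at \<eta> within {0<..})"
    by (rule LIM_zero_cancel)
qed

text \<open>
  Comparing the Tikhonov energy with that of \<open>v\<close> bounds the residual for small \<open>\<epsilon>\<close>. Comparing it
  with that of \<open>0\<close> bounds the norm of the solution by \<open>norm g / sqrt \<epsilon>\<close>, so that for large \<open>\<epsilon>\<close>
  the residual norm comes close to \<open>norm g\<close>.
\<close>

lemma is_discrepancy_parameter_exists:
  fixes A :: "'v::{real_inner, complete_space} \<Rightarrow> 'h::{real_inner, complete_space}"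
  assumes "bounded_linear A" and "norm (A v - g) < \<delta>" and "\<delta> < norm g"
  obtains \<epsilon> where "is_discrepancy_parameter A g \<delta> \<epsilon>"
proof -
  interpret A: bounded_linear A by fact
  define \<phi> where "\<phi> = (\<lambda>\<epsilon>. norm (A (tikhonov_solution A g \<epsilon>) - g))"
  have \<delta>: "\<delta> > 0"
    using assms(2) norm_ge_zero[of "A v - g"] by linarith
  have energy: "(\<phi> \<epsilon>)\<^sup>2 + \<epsilon> * (norm (tikhonov_solution A g \<epsilon>))\<^sup>2 \<le> (norm (A w - g))\<^sup>2 + \<epsilon> * (norm w)\<^sup>2"
    if "\<epsilon> > 0" for \<epsilon> w
  proof -
    have "is_tikhonov_solution A g \<epsilon> (tikhonov_solution A g \<epsilon>)"
      using tikhonov_solution_iff[OF assms(1) that] by blast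
    from tikhonov_energy_identity[OF assms(1) this, of w] that
    show ?thesis unfolding \<phi>_def
      by (simp add: mult_nonneg_nonneg)
  qed
  \<comment> \<open>chosen so that the energy of \<open>v\<close> at the parameter \<open>a\<close> is at most \<open>\<delta>\<^sup>2\<close>; the summand 1 covers
    \<open>v = 0\<close>\<close>
  define a where "a = (\<delta>\<^sup>2 - (norm (A v - g))\<^sup>2) / ((norm v)\<^sup>2 + 1)"
  have gap: "\<delta>\<^sup>2 - (norm (A v - g))\<^sup>2 > 0"
    using assms(2) \<delta> by (simp add: power_strict_mono)
  have den: "(norm v)\<^sup>2 + 1 > 0"
    by (rule add_nonneg_pos) auto
  have a: "a > 0"
    unfolding a_def using gap den by (rule divide_pos_pos)
  have phi_a: "\<phi> a \<le> \<delta>"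
  proof -
    have "a * ((norm v)\<^sup>2 + 1) = \<delta>\<^sup>2 - (norm (A v - g))\<^sup>2"
      unfolding a_def using den by simp
    then have "a * (norm v)\<^sup>2 \<le> \<delta>\<^sup>2 - (norm (A v - g))\<^sup>2"
      using a by (simp add: distrib_left)
    moreover have "a * (norm (tikhonov_solution A g a))\<^sup>2 \<ge> 0" using a by simp
    ultimately have "(\<phi> a)\<^sup>2 \<le> \<delta>\<^sup>2"
      using energy[OF a, of v] by linarith
    then show ?thesis using \<delta> by (auto intro: power2_le_imp_le)
  qed
  obtain K where K: "K > 0" "\<And>x. norm (A x) \<le> norm x * K"
    using A.pos_bounded by blast
  \<comment> \<open>at parameters of at least \<open>c\<^sup>2\<close> the solution has norm at most \<open>norm g / c\<close>, hence an image of
    norm at most \<open>norm g - \<delta>\<close>\<close>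
  define c where "c = K * norm g / (norm g - \<delta>)"
  have c: "c > 0"
    unfolding c_def using K(1) \<delta> assms(3) by (intro divide_pos_pos mult_pos_pos) auto
  define b where "b = max a (c\<^sup>2)"
  have b: "b > 0" "a \<le> b" "c\<^sup>2 \<le> b"
    using a by (auto simp: b_def)
  have phi_b: "\<delta> \<le> \<phi> b"
  proof -
    let ?u = "tikhonov_solution A g b"
    have "(c * norm ?u)\<^sup>2 \<le> b * (norm ?u)\<^sup>2"
      using b(3) by (simp add: power_mult_distrib mult_right_mono)
    also have "\<dots> \<le> (norm g)\<^sup>2"
      using energy[OF b(1), of 0] by (simp add: A.zero) (smt (verit) zero_le_power2)
    finally have "c * norm ?u \<le> norm g"
      by (rule power2_le_imp_le) simp
    then have "K * norm ?u * norm g \<le> (norm g - \<delta>) * norm g"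
      using assms(3) by (simp add: c_def field_simps)
    moreover have "norm g > 0"
      using \<delta> assms(3) by linarith
    ultimately have "K * norm ?u \<le> norm g - \<delta>"
      by (rule mult_right_le_imp_le)
    moreover have "norm g \<le> norm (A ?u) + \<phi> b"
      unfolding \<phi>_def using norm_triangle_ineq4[of "A ?u" "A ?u - g"] by simp
    ultimately show ?thesis
      using K(2)[of ?u] by (simp add: mult.commute)
  qed
  have "continuous_on {a..b} (\<lambda>\<epsilon>. tikhonov_solution A g \<epsilon>)"
    by (rule continuous_on_subset[OF continuous_on_tikhonov_solution[OF assms(1)]]) (use a in auto)
  then have "continuous_on {a..b} \<phi>"
    unfolding \<phi>_def by (intro continuous_intros A.continuous_on)
  then obtain \<epsilon> where "a \<le> \<epsilon>" "\<phi> \<epsilon> = \<delta>"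
    using IVT'[of \<phi> a \<delta> b] phi_a phi_b b(2) by blast
  then show thesis
    using that[of \<epsilon>] a by (simp add: is_discrepancy_parameter_def \<phi>_def)
qed

section \<open>The dual problem\<close>

text \<open>
  The explicit solution of the dual problem by the rescaled residual, from the completed square
  \<open>dual_eq\<close> in the proof.
\<close>

lemma is_dual_solution_iff_residual:
  fixes A :: "'v::{real_inner, complete_space} \<Rightarrow> 'h::{real_inner, complete_space}"
  assumes A: "bounded_linear A" and "\<delta> > 0" and "\<delta> < norm g"
    and disc: "is_discrepancy_parameter A g \<delta> \<epsilon>"
  defines "u \<equiv> tikhonov_solution A g \<epsilon>"
  defines "p \<equiv> (1 / \<epsilon>) *\<^sub>R (g - A u)"
  shows "adjoint A p = u" and "norm p = \<delta> / \<epsilon>"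
    and "is_dual_solution A g \<delta> q \<longleftrightarrow> q = p"
proof -
  interpret A: bounded_linear A by fact
  have \<epsilon>: "\<epsilon> > 0" and res: "norm (A u - g) = \<delta>"
    using disc by (auto simp: is_discrepancy_parameter_def u_def)
  have "is_tikhonov_solution A g \<epsilon> u"
    using tikhonov_solution_iff[OF A \<epsilon>] by (simp add: u_def)
  then have tik: "inner (A u) (A v) + \<epsilon> * inner u v = inner g (A v)" for v
    by (simp add: is_tikhonov_solution_def)
  have adj: "inner v (adjoint A q) = inner (A v) q" for v q
    by (rule adjoint_inner[OF A])
  have "inner v (adjoint A p) = inner v u" for v
  proof -
    have "inner (A v) (g - A u) = \<epsilon> * inner v u"
      using tik[of v] by (simp add: inner_diff_right inner_commute)
    then show ?thesis
      using \<epsilon> by (simp add: adj p_def)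
  qed
  then show adj_p: "adjoint A p = u"
    using vector_eq_ldot by blast
  show norm_p: "norm p = \<delta> / \<epsilon>"
    using res \<epsilon> by (simp add: p_def norm_minus_commute)
  have g_eq: "g = A u + \<epsilon> *\<^sub>R p"
    using \<epsilon> by (simp add: p_def)
  have dual_eq: "dual_functional A g \<delta> q = - (1 / 2) * (norm u)\<^sup>2
      + (1 / 2 * (norm (adjoint A q - u))\<^sup>2 + \<epsilon> * (norm p * norm q - inner p q))" for q
  proof -
    have "inner g q = inner u (adjoint A q) + \<epsilon> * inner p q"
      by (subst g_eq) (simp add: inner_simps adj)
    moreover have "(norm (adjoint A q - u))\<^sup>2
        = (norm (adjoint A q))\<^sup>2 - 2 * inner u (adjoint A q) + (norm u)\<^sup>2"
      by (simp add: power2_norm_eq_inner inner_simps inner_commute)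
    moreover have "\<epsilon> * (norm p * norm q) = \<delta> * norm q"
      using norm_p \<epsilon> by simp
    ultimately show ?thesis
      unfolding dual_functional_def right_diff_distrib by linarith
  qed
  have dual_p: "dual_functional A g \<delta> p = - (1 / 2) * (norm u)\<^sup>2"
    by (simp add: dual_eq adj_p power2_norm_eq_inner flip: power2_eq_square)
  have cs: "\<epsilon> * (norm p * norm q - inner p q) \<ge> 0" for q
    using \<epsilon> norm_cauchy_schwarz[of p q] by simp
  have p_sol: "is_dual_solution A g \<delta> p"
    unfolding is_dual_solution_def dual_p using dual_eq cs by simp
  have "q = p" if "is_dual_solution A g \<delta> q"
  proof -
    have "dual_functional A g \<delta> q \<le> dual_functional A g \<delta> p"
      using that by (simp add: is_dual_solution_def)
    then have "1 / 2 * (norm (adjoint A q - u))\<^sup>2 + \<epsilon> * (norm p * norm q - inner p q) \<le> 0"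
      unfolding dual_p dual_eq[of q] by simp
    then have "(norm (adjoint A q - u))\<^sup>2 = 0" and *: "\<epsilon> * (norm p * norm q - inner p q) = 0"
      using cs[of q] zero_le_power2[of "norm (adjoint A q - u)"] by linarith+
    then have adj_q: "adjoint A q = u" by simp
    have "inner p q = norm p * norm q"
      using * \<epsilon> by simp
    then have par: "norm p *\<^sub>R q = norm q *\<^sub>R p"
      using norm_cauchy_schwarz_eq by blast
    \<comment> \<open>apply the adjoint to both sides of the parallelism relation and pair with \<open>u\<close>\<close>
    have "norm p * inner u u = inner (A u) (norm p *\<^sub>R q)"
      using adj[of u q] adj_q by simp
    also have "\<dots> = norm q * inner u u"
      using adj[of u p] adj_p by (simp add: par)
    finally have "(norm p - norm q) * inner u u = 0"
      by (simp add: algebra_simps)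
    moreover have "u \<noteq> 0"
      using res assms(3) by (auto simp: A.zero)
    ultimately have "norm p = norm q" by simp
    moreover have "norm p \<noteq> 0"
      using norm_p \<epsilon> assms(2) by simp
    ultimately show ?thesis using par by simp
  qed
  with p_sol show "is_dual_solution A g \<delta> q \<longleftrightarrow> q = p" by blast
qed

theorem theorem2p5:
  fixes A :: "'v::{real_inner, complete_space} \<Rightarrow> 'h::{real_inner, complete_space}"
    and g :: 'h and \<delta> :: real
  assumes "bounded_linear A" and "inj A"
    and "\<delta> > 0"
    and "norm (orthogonal_projection ((range A)\<^sup>\<bottom>) g) < \<delta>" and "\<delta> < norm g"
  shows "(\<exists>p. is_dual_solution A g \<delta> p)
    \<and> (\<forall>\<epsilon>>0. \<exists>!u. is_tikhonov_solution A g \<epsilon> u)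
    \<and> (\<exists>!\<epsilon>. is_discrepancy_parameter A g \<delta> \<epsilon>)
    \<and> (\<forall>p. is_dual_solution A g \<delta> p \<longrightarrow>
          adjoint A p = tikhonov_solution A g (discrepancy_parameter A g \<delta>)
        \<and> p \<noteq> 0
        \<and> discrepancy_parameter A g \<delta> = \<delta> / norm p)"
proof -
  note dual = is_dual_solution_iff_residual[OF assms(1,3,5)]
  obtain v where "norm (A v - g) < \<delta>"
    using near_orthogonal_projection_range[OF assms(1,4)] .
  then obtain \<epsilon> where \<epsilon>: "is_discrepancy_parameter A g \<delta> \<epsilon>"
    using is_discrepancy_parameter_exists[OF assms(1) _ assms(5)] by blast
  have param_eq: "\<eta> = \<delta> / norm p"
    if "is_discrepancy_parameter A g \<delta> \<eta>" "is_dual_solution A g \<delta> p" for \<eta> p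
  proof -
    have "norm p = \<delta> / \<eta>"
      using dual(2,3)[OF that(1)] that(2) by metis
    then show ?thesis using assms(3) by simp
  qed
  have ex: "\<exists>p. is_dual_solution A g \<delta> p"
    using dual(3)[OF \<epsilon>] by blast
  then have ex1: "\<exists>!\<epsilon>. is_discrepancy_parameter A g \<delta> \<epsilon>"
    using \<epsilon> param_eq by blast
  then have eq: "discrepancy_parameter A g \<delta> = \<epsilon>"
    unfolding discrepancy_parameter_def using \<epsilon> by blast
  have "adjoint A p = tikhonov_solution A g \<epsilon> \<and> p \<noteq> 0 \<and> \<epsilon> = \<delta> / norm p"
    if p: "is_dual_solution A g \<delta> p" for p
  proof -
    have "\<epsilon> = \<delta> / norm p" using param_eq[OF \<epsilon> p] .
    moreover have "\<epsilon> > 0" using \<epsilon> by (simp add: is_discrepancy_parameter_def)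
    moreover have "adjoint A p = tikhonov_solution A g \<epsilon>"
      using dual(1,3)[OF \<epsilon>] p by metis
    ultimately show ?thesis by auto
  qed
  moreover have "\<forall>\<epsilon>>0. \<exists>!u. is_tikhonov_solution A g \<epsilon> u"
    using tikhonov_solution_iff[OF assms(1)] by simp
  ultimately show ?thesis
    unfolding eq using ex ex1 by simp
qed

end
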